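(* Let $\mathcal{R}$ be an associative ring with unit $1\neq 0$ and let $a,b,c,x\in\mathcal{R}$. The following assertions are equivalent (where each parenthetical "or" gives an alternative condition that may replace the condition immediately preceding it): (1) $x=a^{(2)}_{{\rm rprin}=b\mathcal{R},{\rm rann}={\rm rann}(c)}$ and $x\in\mathcal{R}c$ (or $c\{1\}\neq\emptyset$). (2) $x=a^{(2)}_{{\rm rprin}=b\mathcal{R},{\rm rann}={\rm rann}(c)}$ and $(cab)\{1\}\neq\emptyset$. (3) $x=a^{(2)}_{{\rm lprin}=\mathcal{R}c,{\rm lann}={\rm lann}(b)}$ and $x\in b\mathcal{R}$ (or $b\{1\}\neq\emptyset$). (4) $x=a^{(2)}_{{\rm lprin}=\mathcal{R}c,{\rm lann}={\rm lann}(b)}$ and $(cab)\{1\}\neq\emptyset$. (5) $x=a^{(2)}_{{\rm rprin}=b\mathcal{R},{\rm lprin}=\mathcal{R}c}$. (6) $x=a^{(2)}_{{\rm lann}={\rm lann}(b),{\rm rann}={\rm rann}(c)}$ and $x\in b\mathcal{R}$ (or $b\{1\}\neq\emptyset$) and $x\in\mathcal{R}c$ (or $c\{1\}\neq\emptyset$). (7) $x=a^{(2)}_{{\rm lann}={\rm lann}(b),{\rm rann}={\rm rann}(c)}$ and $(cab)\{1\}\neq\emptyset$. (8) $(cab)\{1\}\neq\emptyset$, $\mathcal{R}cab=\mathcal{R}b$ (or ${\rm rann}(cab)={\rm rann}(b)$), $cab\mathcal{R}=c\mathcal{R}$ (or ${\rm lann}(cab)={\rm lann}(c)$), and $x=b(cab)^{(1)}c$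 for any $(cab)^{(1)}\in(cab)\{1\}$.
   Context: For $a\in\mathcal{R}$: $a\{1\}=\{x\in\mathcal{R}:axa=a\}$, $a\{2\}=\{x\in\mathcal{R}:xax=x\}$, $a\mathcal{R}=\{ar:r\in\mathcal{R}\}$, $\mathcal{R}a=\{ra:r\in\mathcal{R}\}$, ${\rm rann}(a)=\{r\in\mathcal{R}:ar=0\}$, ${\rm lann}(a)=\{r\in\mathcal{R}:ra=0\}$. The symbols $a^{(2)}_{\ldots}$ denote the (unique, if it exists) $x\in a\{2\}$ satisfying the two prescribed conditions, where ${\rm rprin}=\mathcal{S}$ means $x\mathcal{R}=\mathcal{S}$, ${\rm lprin}=\mathcal{S}'$ means $\mathcal{R}x=\mathcal{S}'$, ${\rm rann}=\mathcal{T}$ means ${\rm rann}(x)=\mathcal{T}$, and ${\rm lann}=\mathcal{T}'$ means ${\rm lann}(x)=\mathcal{T}'$. So e.g. $x=a^{(2)}_{{\rm rprin}=b\mathcal{R},{\rm rann}={\rm rann}(c)}$ means $xax=x$, $x\mathcal{R}=b\mathcal{R}$, ${\rm rann}(x)={\rm rann}(c)$. *)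

theory Defs
  imports Main
begin

definition inner_inverses :: "'a::ring_1 \<Rightarrow> 'a set" where
  "inner_inverses a = {x. a * x * a = a}"

definition outer_inverses :: "'a::ring_1 \<Rightarrow> 'a set" where
  "outer_inverses a = {x. x * a * x = x}"

definition rprin :: "'a::ring_1 \<Rightarrow> 'a set" where
  "rprin a = {a * r | r. True}"

definition lprin :: "'a::ring_1 \<Rightarrow> 'a set" where
  "lprin a = {r * a | r. True}"

definition rann :: "'a::ring_1 \<Rightarrow> 'a set" where
  "rann a = {r. a * r = 0}"

definition lann :: "'a::ring_1 \<Rightarrow> 'a set" where
  "lann a = {r. r * a = 0}"

(* The predicates below render "x is the outer inverse of a with the two prescribed
   sets". Such an x need not exist, so it is a relation rather than a function of a and
   the sets; the uniqueness lemmas justify reading it as an equation for x. *)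

definition outer_rprin_rann :: "'a::ring_1 \<Rightarrow> 'a set \<Rightarrow> 'a set \<Rightarrow> 'a \<Rightarrow> bool" where
  "outer_rprin_rann a S T x \<longleftrightarrow> x \<in> outer_inverses a \<and> rprin x = S \<and> rann x = T"

definition outer_lprin_lann :: "'a::ring_1 \<Rightarrow> 'a set \<Rightarrow> 'a set \<Rightarrow> 'a \<Rightarrow> bool" where
  "outer_lprin_lann a S T x \<longleftrightarrow> x \<in> outer_inverses a \<and> lprin x = S \<and> lann x = T"

definition outer_rprin_lprin :: "'a::ring_1 \<Rightarrow> 'a set \<Rightarrow> 'a set \<Rightarrow> 'a \<Rightarrow> bool" where
  "outer_rprin_lprin a S T x \<longleftrightarrow> x \<in> outer_inverses a \<and> rprin x = S \<and> lprin x = T"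

definition outer_lann_rann :: "'a::ring_1 \<Rightarrow> 'a set \<Rightarrow> 'a set \<Rightarrow> 'a \<Rightarrow> bool" where
  "outer_lann_rann a S T x \<longleftrightarrow> x \<in> outer_inverses a \<and> lann x = S \<and> rann x = T"

lemma outer_eq_of_rprin:
  assumes "x \<in> outer_inverses a" "rprin x = rprin y"
  shows "x * a * y = y"
proof -
  have "y * 1 \<in> rprin y" unfolding rprin_def by blast
  then obtain r where "y = x * r" using assms(2) by (auto simp: rprin_def)
  then show ?thesis using assms(1) by (simp add: outer_inverses_def mult.assoc[symmetric])
qed

lemma outer_eq_of_lprin:
  assumes "x \<in> outer_inverses a" "lprin x = lprin y"
  shows "y * a * x = y"
proof -
  have "1 * y \<in> lprin y" unfolding lprin_def by blast
  then obtain r where "y = r * x" using assms(2) by (auto simp: lprin_def)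
  then show ?thesis using assms(1) by (simp add: outer_inverses_def mult.assoc)
qed

lemma outer_eq_of_rann:
  assumes "x \<in> outer_inverses a" "rann x = rann y"
  shows "y * a * x = y"
proof -
  have ann: "a * x - 1 \<in> rann x"
    using assms(1) by (simp add: rann_def outer_inverses_def right_diff_distrib mult.assoc)
  from ann[unfolded assms(2)] show ?thesis by (simp add: rann_def right_diff_distrib mult.assoc)
qed

lemma outer_eq_of_lann:
  assumes "x \<in> outer_inverses a" "lann x = lann y"
  shows "x * a * y = y"
proof -
  have ann: "x * a - 1 \<in> lann x"
    using assms(1) by (simp add: lann_def outer_inverses_def left_diff_distrib)
  from ann[unfolded assms(2)] show ?thesis by (simp add: lann_def left_diff_distrib)
qed

lemma outer_rprin_rann_unique:
  "outer_rprin_rann a S T x \<Longrightarrow> outer_rprin_rann a S T y \<Longrightarrow> x = y"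
  unfolding outer_rprin_rann_def by (metis outer_eq_of_rprin outer_eq_of_rann)

lemma outer_lprin_lann_unique:
  "outer_lprin_lann a S T x \<Longrightarrow> outer_lprin_lann a S T y \<Longrightarrow> x = y"
  unfolding outer_lprin_lann_def by (metis outer_eq_of_lprin outer_eq_of_lann)

lemma outer_rprin_lprin_unique:
  "outer_rprin_lprin a S T x \<Longrightarrow> outer_rprin_lprin a S T y \<Longrightarrow> x = y"
  unfolding outer_rprin_lprin_def by (metis outer_eq_of_rprin outer_eq_of_lprin)

lemma outer_lann_rann_unique:
  "outer_lann_rann a S T x \<Longrightarrow> outer_lann_rann a S T y \<Longrightarrow> x = y"
  unfolding outer_lann_rann_def by (metis outer_eq_of_lann outer_eq_of_rann)

definition all_equivalent :: "bool list \<Rightarrow> bool" where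
  "all_equivalent Ps \<longleftrightarrow> (\<forall>P\<in>set Ps. \<forall>Q\<in>set Ps. P \<longleftrightarrow> Q)"

end

theory Submission
  imports Defs
begin

text \<open>
  Each of the first seven assertions implies the annihilator condition
  \<open>W\<close>: \<open>x * a * x = x\<close>, \<open>lann x = lann b\<close>, \<open>rann x = rann c\<close>. Under \<open>W\<close> one has
  \<open>x * a * b = b\<close> and \<open>c * a * x = c\<close>, so \<open>b\<close> lies in \<open>x\<R>\<close> and \<open>c\<close> in \<open>\<R>x\<close>; prescribing
  \<open>x\<R> = b\<R>\<close> instead of the left annihilator therefore adds just the membership
  \<open>x \<in> b\<R>\<close>, and symmetrically for \<open>\<R>x = \<R>c\<close>.

  These memberships are regularity conditions in disguise (\<open>z\<close> is regular if \<open>z * g * z = z\<close>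
  for some \<open>g\<close>). If \<open>x = b * u\<close>, then
  \<open>b = x * a * b = b * u * a * b\<close>. If \<open>b = b * g * b\<close>, then \<open>1 - b * g\<close> annihilates \<open>b\<close>, hence
  \<open>x\<close>, from the left, so \<open>x = b * g * x\<close>. Finally, \<open>W\<close> makes \<open>c * a * b\<close> have the right
  annihilator of \<open>b\<close> and the left annihilator of \<open>c\<close>, and the same cancellation shows that
  \<open>c * a * b\<close> is regular exactly when \<open>b\<close> and \<open>c\<close> both are. Thus each of the first seven
  assertions says \<open>W\<close> together with \<open>x \<in> b\<R>\<close> and \<open>x \<in> \<R>c\<close>.

  For the last assertion, an inner inverse \<open>g\<close> of \<open>c * a * b\<close> satisfies
  \<open>b = b * g * (c * a * b)\<close> and \<open>c = (c * a * b) * g * c\<close> by cancellation, and this is what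
  makes \<open>b * g * c\<close> an outer inverse of \<open>a\<close> generating \<open>b\<R>\<close> and \<open>\<R>c\<close>.
\<close>

section \<open>Principal ideals and annihilators\<close>

lemma mem_rprin_iff: "x \<in> rprin b \<longleftrightarrow> (\<exists>u. x = b * u)"
  by (auto simp: rprin_def)

lemma mem_lprin_iff: "x \<in> lprin c \<longleftrightarrow> (\<exists>v. x = v * c)"
  by (auto simp: lprin_def)

lemma rprin_subset_iff: "rprin x \<subseteq> rprin b \<longleftrightarrow> x \<in> rprin b"
proof
  assume "rprin x \<subseteq> rprin b"
  moreover have "x \<in> rprin x" by (metis mem_rprin_iff mult_1_right)
  ultimately show "x \<in> rprin b" by blast
next
  assume "x \<in> rprin b"
  then show "rprin x \<subseteq> rprin b" by (force simp: rprin_def mult.assoc)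
qed

lemma lprin_subset_iff: "lprin x \<subseteq> lprin c \<longleftrightarrow> x \<in> lprin c"
proof
  assume "lprin x \<subseteq> lprin c"
  moreover have "x \<in> lprin x" by (metis mem_lprin_iff mult_1_left)
  ultimately show "x \<in> lprin c" by blast
next
  assume "x \<in> lprin c"
  then show "lprin x \<subseteq> lprin c" by (force simp: lprin_def mult.assoc[symmetric])
qed

lemma rprin_eq_iff: "rprin x = rprin b \<longleftrightarrow> x \<in> rprin b \<and> b \<in> rprin x"
  by (metis rprin_subset_iff subset_antisym order_refl)

lemma lprin_eq_iff: "lprin x = lprin c \<longleftrightarrow> x \<in> lprin c \<and> c \<in> lprin x"
  by (metis lprin_subset_iff subset_antisym order_refl)

lemma lann_anti_rprin: "x \<in> rprin b \<Longrightarrow> lann b \<subseteq> lann x"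
  by (auto simp: rprin_def lann_def mult.assoc[symmetric])

lemma rann_anti_lprin: "x \<in> lprin c \<Longrightarrow> rann c \<subseteq> rann x"
  by (auto simp: lprin_def rann_def mult.assoc)

lemma lann_eq_of_rprin_eq: "rprin x = rprin b \<Longrightarrow> lann x = lann b"
  by (simp add: rprin_eq_iff lann_anti_rprin subset_antisym)

lemma rann_eq_of_lprin_eq: "lprin x = lprin c \<Longrightarrow> rann x = rann c"
  by (simp add: lprin_eq_iff rann_anti_lprin subset_antisym)

section \<open>Regular elements\<close>

lemma inner_inverses_nonemptyI: "z * g * z = z \<Longrightarrow> inner_inverses z \<noteq> {}"
  by (auto simp: inner_inverses_def)

text \<open>
  Inclusion of annihilators does not in general imply inclusion of principal ideals; a regular
  \<open>z\<close> repairs this, because \<open>1 - g * z\<close> is then a right annihilator of \<open>z\<close>, hence of \<open>y\<close>.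
\<close>

lemma regular_cancel_rann:
  assumes "g \<in> inner_inverses z" "rann z \<subseteq> rann y"
  shows "y * g * z = y"
proof -
  have "1 - g * z \<in> rann z"
    using assms(1) by (simp add: rann_def inner_inverses_def right_diff_distrib mult.assoc)
  then have "1 - g * z \<in> rann y" using assms(2) by blast
  then show ?thesis by (simp add: rann_def right_diff_distrib mult.assoc)
qed

lemma regular_cancel_lann:
  assumes "g \<in> inner_inverses z" "lann z \<subseteq> lann y"
  shows "z * g * y = y"
proof -
  have "1 - z * g \<in> lann z"
    using assms(1) by (simp add: lann_def inner_inverses_def left_diff_distrib)
  then have "1 - z * g \<in> lann y" using assms(2) by blast
  then show ?thesis by (simp add: lann_def left_diff_distrib)
qed

section \<open>Outer inverses with prescribed annihilators\<close>

lemma outer_lann_rann_eqs: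
  assumes "outer_lann_rann a (lann b) (rann c) x"
  shows "x * a * x = x" "x * a * b = b" "c * a * x = c"
  using assms outer_eq_of_lann outer_eq_of_rann
  by (auto simp: outer_lann_rann_def outer_inverses_def)

lemma outer_rprin_eq_iff:
  assumes "x \<in> outer_inverses a"
  shows "rprin x = rprin b \<longleftrightarrow> lann x = lann b \<and> x \<in> rprin b"
proof
  assume "rprin x = rprin b"
  then show "lann x = lann b \<and> x \<in> rprin b"
    using lann_eq_of_rprin_eq rprin_eq_iff by blast
next
  assume *: "lann x = lann b \<and> x \<in> rprin b"
  then have "b = x * (a * b)"
    using outer_eq_of_lann[OF assms] by (metis mult.assoc)
  then show "rprin x = rprin b"
    using * by (metis rprin_eq_iff mem_rprin_iff)
qed

lemma outer_lprin_eq_iff: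
  assumes "x \<in> outer_inverses a"
  shows "lprin x = lprin c \<longleftrightarrow> rann x = rann c \<and> x \<in> lprin c"
proof
  assume "lprin x = lprin c"
  then show "rann x = rann c \<and> x \<in> lprin c"
    using rann_eq_of_lprin_eq lprin_eq_iff by blast
next
  assume *: "rann x = rann c \<and> x \<in> lprin c"
  then have "c = (c * a) * x"
    using outer_eq_of_rann[OF assms] by metis
  then show "lprin x = lprin c"
    using * by (metis lprin_eq_iff mem_lprin_iff)
qed

lemma outer_rprin_rann_iff:
  "outer_rprin_rann a (rprin b) T x \<longleftrightarrow> outer_lann_rann a (lann b) T x \<and> x \<in> rprin b"
  unfolding outer_rprin_rann_def outer_lann_rann_def using outer_rprin_eq_iff by blast

lemma outer_lprin_lann_iff:
  "outer_lprin_lann a (lprin c) S x \<longleftrightarrow> outer_lann_rann a S (rann c) x \<and> x \<in> lprin c"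
  unfolding outer_lprin_lann_def outer_lann_rann_def using outer_lprin_eq_iff by blast

lemma outer_rprin_lprin_iff:
  "outer_rprin_lprin a (rprin b) (lprin c) x \<longleftrightarrow>
    outer_lann_rann a (lann b) (rann c) x \<and> x \<in> rprin b \<and> x \<in> lprin c"
  unfolding outer_rprin_lprin_def outer_lann_rann_def
  using outer_rprin_eq_iff outer_lprin_eq_iff by blast

section \<open>Membership as regularity\<close>

lemma mem_rprin_iff_regular:
  assumes "outer_lann_rann a (lann b) (rann c) x"
  shows "x \<in> rprin b \<longleftrightarrow> inner_inverses b \<noteq> {}"
proof
  assume "x \<in> rprin b"
  then obtain u where "x = b * u" by (auto simp: mem_rprin_iff)
  then have "b * (u * a) * b = b"
    using outer_lann_rann_eqs(2)[OF assms] by (simp add: mult.assoc)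
  then show "inner_inverses b \<noteq> {}" by (rule inner_inverses_nonemptyI)
next
  assume "inner_inverses b \<noteq> {}"
  then obtain g where "g \<in> inner_inverses b" by blast
  then have "b * g * x = x"
    using assms by (intro regular_cancel_lann) (auto simp: outer_lann_rann_def)
  then show "x \<in> rprin b" by (metis mem_rprin_iff mult.assoc)
qed

lemma mem_lprin_iff_regular:
  assumes "outer_lann_rann a (lann b) (rann c) x"
  shows "x \<in> lprin c \<longleftrightarrow> inner_inverses c \<noteq> {}"
proof
  assume "x \<in> lprin c"
  then obtain v where "x = v * c" by (auto simp: mem_lprin_iff)
  then have "c * (a * v) * c = c"
    using outer_lann_rann_eqs(3)[OF assms] by (simp add: mult.assoc)
  then show "inner_inverses c \<noteq> {}" by (rule inner_inverses_nonemptyI)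
next
  assume "inner_inverses c \<noteq> {}"
  then obtain g where "g \<in> inner_inverses c" by blast
  then have "x * g * c = x"
    using assms by (intro regular_cancel_rann) (auto simp: outer_lann_rann_def)
  then show "x \<in> lprin c" by (metis mem_lprin_iff)
qed

text \<open>
  If \<open>c * (a * b * r) = 0\<close>, then \<open>x * (a * b * r) = 0\<close> because \<open>x\<close> and \<open>c\<close> have the same right
  annihilator, and this product is \<open>b * r\<close>. So multiplying \<open>b\<close> by \<open>c * a\<close> loses nothing
  that the right annihilator sees, and dually for \<open>c\<close>.
\<close>

lemma ann_cab:
  assumes "outer_lann_rann a (lann b) (rann c) x"
  shows "rann (c * a * b) = rann b" "lann (c * a * b) = lann c"
proof -
  note eqs = outer_lann_rann_eqs[OF assms]
  have ann: "lann x = lann b" "rann x = rann c"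
    using assms by (auto simp: outer_lann_rann_def)
  have "b * r = 0" if "c * a * b * r = 0" for r
  proof -
    have "a * b * r \<in> rann x" using that ann(2) by (simp add: rann_def mult.assoc)
    then have "x * a * b * r = 0" by (simp add: rann_def mult.assoc)
    then show ?thesis by (simp only: eqs)
  qed
  then show "rann (c * a * b) = rann b" by (auto simp: rann_def mult.assoc)
  have "r * c = 0" if "r * (c * a * b) = 0" for r
  proof -
    have "r * c * a \<in> lann x" using that ann(1) by (simp add: lann_def mult.assoc)
    then have "r * (c * a * x) = 0" by (simp add: lann_def mult.assoc)
    then show ?thesis by (simp only: eqs)
  qed
  then show "lann (c * a * b) = lann c" by (auto simp: lann_def mult.assoc[symmetric])
qed

lemma cab_cancel:
  assumes "g \<in> inner_inverses (c * a * b)"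
    and "rann (c * a * b) = rann b" "lann (c * a * b) = lann c"
  shows "b * g * (c * a * b) = b" "c * a * b * g * c = c"
  using assms by (auto intro: regular_cancel_rann regular_cancel_lann)

text \<open>
  Writing \<open>x = b * u = v * c\<close>, the element \<open>u * a * v\<close> inverts \<open>c * a * b\<close>: in
  \<open>(c * a * b) * (u * a * v) * (c * a * b)\<close> the factors regroup to \<open>c * a * x * a * x * a * b\<close>.
\<close>

lemma cab_regular_iff:
  assumes "outer_lann_rann a (lann b) (rann c) x"
  shows "inner_inverses (c * a * b) \<noteq> {} \<longleftrightarrow> x \<in> rprin b \<and> x \<in> lprin c"
proof
  assume "inner_inverses (c * a * b) \<noteq> {}"
  then obtain g where g: "g \<in> inner_inverses (c * a * b)" by blast
  have "b * (g * c * a) * b = b" "c * (a * b * g) * c = c"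
    using cab_cancel[OF g ann_cab[OF assms]] by (simp_all add: mult.assoc)
  then show "x \<in> rprin b \<and> x \<in> lprin c"
    using mem_rprin_iff_regular[OF assms] mem_lprin_iff_regular[OF assms]
      inner_inverses_nonemptyI by blast
next
  note eqs = outer_lann_rann_eqs[OF assms]
  assume "x \<in> rprin b \<and> x \<in> lprin c"
  then obtain u v where u: "x = b * u" and v: "x = v * c"
    unfolding mem_rprin_iff mem_lprin_iff by blast
  have "c * a * b * (u * a * v) * (c * a * b) = c * a * (b * u) * a * (v * c) * a * b"
    by (simp add: mult.assoc)
  also have "\<dots> = c * a * x * a * (x * a * b)"
    by (simp only: u[symmetric] v[symmetric] mult.assoc)
  also have "\<dots> = c * a * b" by (simp only: eqs)
  finally show "inner_inverses (c * a * b) \<noteq> {}" by (rule inner_inverses_nonemptyI)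
qed

section \<open>The explicit formula\<close>

text \<open>
  The product \<open>b * g * c\<close> does not depend on the inner inverse \<open>g\<close> of \<open>c * a * b\<close>, because \<open>b\<close>
  is a left multiple and \<open>c\<close> a right multiple of \<open>c * a * b\<close>, so that \<open>g\<close> only ever occurs
  between two copies of that element.
\<close>

lemma outer_rprin_lprin_imp_formula:
  assumes "outer_rprin_lprin a (rprin b) (lprin c) x"
  shows "lprin (c * a * b) = lprin b" "rprin (c * a * b) = rprin c"
    and "g \<in> inner_inverses (c * a * b) \<Longrightarrow> x = b * g * c"
proof -
  have W: "outer_lann_rann a (lann b) (rann c) x"
    and mem: "x \<in> rprin b" "x \<in> lprin c"
    using assms by (simp_all add: outer_rprin_lprin_iff)
  note eqs = outer_lann_rann_eqs[OF W]
  obtain u v where u: "x = b * u" and v: "x = v * c"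
    using mem unfolding mem_rprin_iff mem_lprin_iff by blast
  have b: "b = v * (c * a * b)" using eqs(2) by (simp add: v mult.assoc)
  have c: "c = c * a * b * u" using eqs(3) by (simp add: u mult.assoc)
  show "lprin (c * a * b) = lprin b"
    using b by (metis lprin_eq_iff mem_lprin_iff)
  show "rprin (c * a * b) = rprin c"
    using c by (metis rprin_eq_iff mem_rprin_iff mult.assoc)
  show "x = b * g * c" if "g \<in> inner_inverses (c * a * b)"
  proof -
    have "b * g * c = v * (c * a * b) * g * (c * a * b * u)"
      using b c by simp
    also have "\<dots> = v * (c * a * b * g * (c * a * b)) * u" by (simp add: mult.assoc)
    also have "\<dots> = v * (c * a * b) * u" using that by (simp add: inner_inverses_def)
    also have "\<dots> = x" using b u by simp
    finally show ?thesis by simp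
  qed
qed

lemma formula_imp_outer_rprin_lprin:
  assumes g: "g \<in> inner_inverses (c * a * b)"
    and ann: "rann (c * a * b) = rann b" "lann (c * a * b) = lann c"
  shows "outer_rprin_lprin a (rprin b) (lprin c) (b * g * c)"
proof -
  note cancel = cab_cancel[OF g ann]
  have "b * g * c * a * (b * g * c) = b * g * (c * a * b * g * c)" by (simp add: mult.assoc)
  then have "b * g * c \<in> outer_inverses a" by (simp only: cancel outer_inverses_def mem_Collect_eq)
  moreover have "rprin (b * g * c) = rprin b"
    unfolding rprin_eq_iff mem_rprin_iff using cancel(1) by (metis mult.assoc)
  moreover have "lprin (b * g * c) = lprin c"
    unfolding lprin_eq_iff mem_lprin_iff using cancel(2) by (metis mult.assoc)
  ultimately show ?thesis by (simp add: outer_rprin_lprin_def)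
qed

text \<open>
  The strongest form of the formula prescribes principal ideals, the weakest only annihilators.
  Its four variants are handled at once by deriving the strongest from the outer inverse and the
  outer inverse from the weakest.
\<close>

lemma outer_rprin_lprin_iff_formula:
  assumes L: "lprin (c * a * b) = lprin b \<Longrightarrow> L" "L \<Longrightarrow> rann (c * a * b) = rann b"
    and R: "rprin (c * a * b) = rprin c \<Longrightarrow> R" "R \<Longrightarrow> lann (c * a * b) = lann c"
  shows "inner_inverses (c * a * b) \<noteq> {} \<and> L \<and> R \<and>
      (\<forall>g\<in>inner_inverses (c * a * b). x = b * g * c) \<longleftrightarrow>
    outer_rprin_lprin a (rprin b) (lprin c) x"
proof
  assume *: "inner_inverses (c * a * b) \<noteq> {} \<and> L \<and> R \<and>
    (\<forall>g\<in>inner_inverses (c * a * b). x = b * g * c)"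
  then obtain g where "g \<in> inner_inverses (c * a * b)" "x = b * g * c" by blast
  then show "outer_rprin_lprin a (rprin b) (lprin c) x"
    using * L(2) R(2) formula_imp_outer_rprin_lprin by blast
next
  assume *: "outer_rprin_lprin a (rprin b) (lprin c) x"
  have "inner_inverses (c * a * b) \<noteq> {}"
    using * cab_regular_iff by (auto simp: outer_rprin_lprin_iff)
  then show "inner_inverses (c * a * b) \<noteq> {} \<and> L \<and> R \<and>
    (\<forall>g\<in>inner_inverses (c * a * b). x = b * g * c)"
    using outer_rprin_lprin_imp_formula[OF *] L(1) R(1) by blast
qed

section \<open>The equivalence\<close>

lemma all_equivalentI: "(\<And>P. P \<in> set Ps \<Longrightarrow> P \<longleftrightarrow> Q) \<Longrightarrow> all_equivalent Ps"
  by (auto simp: all_equivalent_def)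

theorem theorem7p15:
  fixes a b c x :: "'a :: ring_1"
  shows "all_equivalent
    [ \<comment> \<open>(1), both variants\<close>
      outer_rprin_rann a (rprin b) (rann c) x \<and> x \<in> lprin c,
      outer_rprin_rann a (rprin b) (rann c) x \<and> inner_inverses c \<noteq> {},
      \<comment> \<open>(2)\<close>
      outer_rprin_rann a (rprin b) (rann c) x \<and> inner_inverses (c * a * b) \<noteq> {},
      \<comment> \<open>(3), both variants\<close>
      outer_lprin_lann a (lprin c) (lann b) x \<and> x \<in> rprin b,
      outer_lprin_lann a (lprin c) (lann b) x \<and> inner_inverses b \<noteq> {},
      \<comment> \<open>(4)\<close>
      outer_lprin_lann a (lprin c) (lann b) x \<and> inner_inverses (c * a * b) \<noteq> {},
      \<comment> \<open>(5)\<close>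
      outer_rprin_lprin a (rprin b) (lprin c) x,
      \<comment> \<open>(6), all four variants\<close>
      outer_lann_rann a (lann b) (rann c) x \<and> x \<in> rprin b \<and> x \<in> lprin c,
      outer_lann_rann a (lann b) (rann c) x \<and> x \<in> rprin b \<and> inner_inverses c \<noteq> {},
      outer_lann_rann a (lann b) (rann c) x \<and> inner_inverses b \<noteq> {} \<and> x \<in> lprin c,
      outer_lann_rann a (lann b) (rann c) x \<and> inner_inverses b \<noteq> {} \<and> inner_inverses c \<noteq> {},
      \<comment> \<open>(7)\<close>
      outer_lann_rann a (lann b) (rann c) x \<and> inner_inverses (c * a * b) \<noteq> {},
      \<comment> \<open>(8), all four variants\<close>
      inner_inverses (c * a * b) \<noteq> {} \<and> lprin (c * a * b) = lprin b \<and>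
        rprin (c * a * b) = rprin c \<and> (\<forall>g\<in>inner_inverses (c * a * b). x = b * g * c),
      inner_inverses (c * a * b) \<noteq> {} \<and> lprin (c * a * b) = lprin b \<and>
        lann (c * a * b) = lann c \<and> (\<forall>g\<in>inner_inverses (c * a * b). x = b * g * c),
      inner_inverses (c * a * b) \<noteq> {} \<and> rann (c * a * b) = rann b \<and>
        rprin (c * a * b) = rprin c \<and> (\<forall>g\<in>inner_inverses (c * a * b). x = b * g * c),
      inner_inverses (c * a * b) \<noteq> {} \<and> rann (c * a * b) = rann b \<and>
        lann (c * a * b) = lann c \<and> (\<forall>g\<in>inner_inverses (c * a * b). x = b * g * c)
    ]"
proof -
  let ?E = "outer_rprin_lprin a (rprin b) (lprin c) x"
  let ?W = "outer_lann_rann a (lann b) (rann c) x"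
  note regular = mem_rprin_iff_regular[of a b c x] mem_lprin_iff_regular[of a b c x]
    cab_regular_iff[of a b c x]
  have W_variants:
    "?W \<and> x \<in> rprin b \<and> x \<in> lprin c \<longleftrightarrow> ?E"
    "?W \<and> x \<in> rprin b \<and> inner_inverses c \<noteq> {} \<longleftrightarrow> ?E"
    "?W \<and> inner_inverses b \<noteq> {} \<and> x \<in> lprin c \<longleftrightarrow> ?E"
    "?W \<and> inner_inverses b \<noteq> {} \<and> inner_inverses c \<noteq> {} \<longleftrightarrow> ?E"
    "?W \<and> inner_inverses (c * a * b) \<noteq> {} \<longleftrightarrow> ?E"
    unfolding outer_rprin_lprin_iff using regular by blast+
  have rprin_variants:
    "outer_rprin_rann a (rprin b) (rann c) x \<and> x \<in> lprin c \<longleftrightarrow> ?E"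
    "outer_rprin_rann a (rprin b) (rann c) x \<and> inner_inverses c \<noteq> {} \<longleftrightarrow> ?E"
    "outer_rprin_rann a (rprin b) (rann c) x \<and> inner_inverses (c * a * b) \<noteq> {} \<longleftrightarrow> ?E"
    unfolding outer_rprin_lprin_iff outer_rprin_rann_iff using regular by blast+
  have lprin_variants:
    "outer_lprin_lann a (lprin c) (lann b) x \<and> x \<in> rprin b \<longleftrightarrow> ?E"
    "outer_lprin_lann a (lprin c) (lann b) x \<and> inner_inverses b \<noteq> {} \<longleftrightarrow> ?E"
    "outer_lprin_lann a (lprin c) (lann b) x \<and> inner_inverses (c * a * b) \<noteq> {} \<longleftrightarrow> ?E"
    unfolding outer_rprin_lprin_iff outer_lprin_lann_iff using regular by blast+
  note formula = outer_rprin_lprin_iff_formula[of c a b _ _ x]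
  note weaken = rann_eq_of_lprin_eq lann_eq_of_rprin_eq
  have formula_variants:
    "inner_inverses (c * a * b) \<noteq> {} \<and> lprin (c * a * b) = lprin b \<and>
      rprin (c * a * b) = rprin c \<and> (\<forall>g\<in>inner_inverses (c * a * b). x = b * g * c) \<longleftrightarrow> ?E"
    "inner_inverses (c * a * b) \<noteq> {} \<and> lprin (c * a * b) = lprin b \<and>
      lann (c * a * b) = lann c \<and> (\<forall>g\<in>inner_inverses (c * a * b). x = b * g * c) \<longleftrightarrow> ?E"
    "inner_inverses (c * a * b) \<noteq> {} \<and> rann (c * a * b) = rann b \<and>
      rprin (c * a * b) = rprin c \<and> (\<forall>g\<in>inner_inverses (c * a * b). x = b * g * c) \<longleftrightarrow> ?E"
    "inner_inverses (c * a * b) \<noteq> {} \<and> rann (c * a * b) = rann b \<and>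
      lann (c * a * b) = lann c \<and> (\<forall>g\<in>inner_inverses (c * a * b). x = b * g * c) \<longleftrightarrow> ?E"
    by (rule formula; (assumption | erule weaken))+
  show ?thesis
    by (rule all_equivalentI[where Q = ?E], unfold list.set insert_iff empty_iff,
        elim disjE FalseE; hypsubst, (rule refl W_variants rprin_variants lprin_variants formula_variants))
qed

end
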